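(* Let $X \in \mathbb{R}^{n\times p}$, let $S^0 \subset \{1,\dots,p\}$ be such that $X_{S^0}^T X_{S^0}$ is invertible, and let $\theta \in (0,1)$. Suppose the $\theta$-uniform irrepresentable condition holds: $$\max_{\|\tau_{S^0}\|_\infty \le 1} \big\| X_{\overline{S^0}}^T X_{S^0} (X_{S^0}^T X_{S^0})^{-1} \tau_{S^0} \big\|_\infty < \theta,$$ where the maximum is over vectors $\tau_{S^0} \in \mathbb{R}^{|S^0|}$. Then for any $\rho \in (\theta, 1)$ the stable null space property with constant $\rho$ holds for $X$ and $S^0$: $$\|\beta_{S^0}\|_1 \le \rho\, \|\beta_{\overline{S^0}}\|_1 \quad \text{for all } \beta \in \ker(X).$$
   Context: For $S \subset \{1,\dots,p\}$, $X_S$ denotes the submatrix of $X$ made of the columns indexed by $S$, $\beta_S$ denotes the subvector of $\beta\in\mathbb{R}^p$ indexed by $S$, and $\overline{S}$ denotes the complement of $S$ in $\{1,\dots,p\}$. *)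

theory Defs
  imports
    Complex_Main
    "Jordan_Normal_Form.DL_Submatrix"
    "Jordan_Normal_Form.Gauss_Jordan_Elimination"
    "Jordan_Normal_Form.Matrix_Kernel"
begin

text \<open>Vectors and matrices are indexed from 0, so index sets are subsets of \<open>{..<p}\<close>.\<close>

abbreviation col_submatrix :: "'a mat \<Rightarrow> nat set \<Rightarrow> 'a mat" where
  "col_submatrix X S \<equiv> submatrix X UNIV S"

text \<open>As in \<^const>\<open>submatrix\<close>, the selected indices are listed in increasing order; hence the
  entries of \<open>subvec \<beta> S\<close> correspond to the columns of \<open>col_submatrix X S\<close>.\<close>

definition subvec :: "'a vec \<Rightarrow> nat set \<Rightarrow> 'a vec" where
  "subvec \<beta> S = vec (card {i. i < dim_vec \<beta> \<and> i \<in> S}) (\<lambda>k. \<beta> $ pick S k)"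

definition l1_norm :: "real vec \<Rightarrow> real" where
  "l1_norm v = (\<Sum>i<dim_vec v. \<bar>v $ i\<bar>)"

text \<open>The inserted 0 only matters for the vector of dimension 0, whose norm is 0.\<close>

definition linf_norm :: "real vec \<Rightarrow> real" where
  "linf_norm v = Max (insert 0 ((\<lambda>i. \<bar>v $ i\<bar>) ` {..<dim_vec v}))"

text \<open>The value of \<^const>\<open>mat_inverse\<close> is \<open>None\<close> on singular matrices, so the definition below is
  meaningful only if the Gram matrix of the columns in \<open>S\<close> is invertible.\<close>

definition irrepresentable_mat :: "real mat \<Rightarrow> nat set \<Rightarrow> real mat" where
  "irrepresentable_mat X S =
     (let XS = col_submatrix X S; XC = col_submatrix X ({..<dim_col X} - S)
      in transpose_mat XC * XS * the (mat_inverse (transpose_mat XS * XS)))"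

text \<open>If the Gram matrix is invertible, the supremum is a maximum: see
  \<open>linf_operator_max_attained\<close> and \<open>irrepresentable_mat_carrier\<close> below.\<close>

definition uniform_irrepresentable :: "real \<Rightarrow> real mat \<Rightarrow> nat set \<Rightarrow> bool" where
  "uniform_irrepresentable \<theta> X S \<longleftrightarrow>
     (SUP \<tau> \<in> {\<tau> \<in> carrier_vec (card S). linf_norm \<tau> \<le> 1}.
        linf_norm (irrepresentable_mat X S *\<^sub>v \<tau>)) < \<theta>"

definition stable_null_space :: "real \<Rightarrow> real mat \<Rightarrow> nat set \<Rightarrow> bool" where
  "stable_null_space \<rho> X S \<longleftrightarrow>
     (\<forall>\<beta> \<in> mat_kernel X.
        l1_norm (subvec \<beta> S) \<le> \<rho> * l1_norm (subvec \<beta> ({..<dim_col X} - S)))"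

lemma linf_norm_le_iff: "linf_norm v \<le> c \<longleftrightarrow> 0 \<le> c \<and> (\<forall>i<dim_vec v. \<bar>v $ i\<bar> \<le> c)"
  unfolding linf_norm_def by (subst Max_le_iff) auto

lemma linf_norm_ge: "i < dim_vec v \<Longrightarrow> \<bar>v $ i\<bar> \<le> linf_norm v"
  using linf_norm_le_iff by blast

lemma linf_norm_nonneg: "0 \<le> linf_norm v"
  using linf_norm_le_iff by blast

lemma linf_operator_max_attained:
  assumes M: "M \<in> carrier_mat m d"
  defines "B \<equiv> {\<tau> \<in> carrier_vec d. linf_norm \<tau> \<le> 1}"
  shows "\<exists>\<tau>\<in>B. linf_norm (M *\<^sub>v \<tau>) = (SUP \<tau>\<in>B. linf_norm (M *\<^sub>v \<tau>)) \<and>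
           (\<forall>\<sigma>\<in>B. linf_norm (M *\<^sub>v \<sigma>) \<le> linf_norm (M *\<^sub>v \<tau>))"
proof -
  define r where "r i = (\<Sum>j<d. \<bar>M $$ (i, j)\<bar>)" for i
  have entry: "(M *\<^sub>v \<sigma>) $ i = (\<Sum>j<d. M $$ (i, j) * \<sigma> $ j)"
    if "i < m" "\<sigma> \<in> carrier_vec d" for i \<sigma>
    using that M by (auto simp: scalar_prod_def lessThan_atLeast0 intro!: sum.cong)
  have le_r: "\<bar>(M *\<^sub>v \<sigma>) $ i\<bar> \<le> r i" if i: "i < m" and \<sigma>: "\<sigma> \<in> B" for i \<sigma>
  proof -
    have "\<bar>M $$ (i, j) * \<sigma> $ j\<bar> \<le> \<bar>M $$ (i, j)\<bar>" if "j < d" for j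
      using \<sigma> that by (auto simp: B_def linf_norm_le_iff abs_mult intro!: mult_left_le)
    then show ?thesis
      using \<sigma> i unfolding r_def
      by (subst entry) (auto simp: B_def intro!: order_trans[OF sum_abs] sum_mono)
  qed
  have zero: "0\<^sub>v d \<in> B"
    by (auto simp: B_def linf_norm_le_iff)
  have "\<exists>\<tau>\<in>B. \<forall>\<sigma>\<in>B. linf_norm (M *\<^sub>v \<sigma>) \<le> linf_norm (M *\<^sub>v \<tau>)"
  proof (cases "m = 0")
    case True
    then have "linf_norm (M *\<^sub>v \<sigma>) = 0" for \<sigma>
      using M by (simp add: linf_norm_def)
    then show ?thesis using zero by auto
  next
    case False
    then have "Max (r ` {..<m}) \<in> r ` {..<m}"
      by (intro Max_in) auto
    then obtain k where k: "k < m" and rk: "r k = Max (r ` {..<m})"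
      by auto
    have k_max: "r i \<le> r k" if "i < m" for i
      using that by (simp add: rk)
    define \<tau> where "\<tau> = vec d (\<lambda>j. sgn (M $$ (k, j)))"
    have \<tau>: "\<tau> \<in> B"
      by (auto simp: B_def \<tau>_def linf_norm_le_iff sgn_if)
    have "(M *\<^sub>v \<tau>) $ k = r k"
      using k by (subst entry) (auto simp: \<tau>_def r_def abs_sgn)
    then have "r k \<le> linf_norm (M *\<^sub>v \<tau>)"
      using linf_norm_ge[of k "M *\<^sub>v \<tau>"] k M by auto
    moreover have "linf_norm (M *\<^sub>v \<sigma>) \<le> r k" if "\<sigma> \<in> B" for \<sigma>
      unfolding linf_norm_le_iff
      using that M le_r k_max by (auto simp: r_def intro!: sum_nonneg intro: order_trans)
    ultimately show ?thesis using \<tau> by (blast intro: order_trans)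
  qed
  then obtain \<tau> where \<tau>: "\<tau> \<in> B"
    and max: "\<And>\<sigma>. \<sigma> \<in> B \<Longrightarrow> linf_norm (M *\<^sub>v \<sigma>) \<le> linf_norm (M *\<^sub>v \<tau>)"
    by blast
  have "(SUP \<sigma>\<in>B. linf_norm (M *\<^sub>v \<sigma>)) = linf_norm (M *\<^sub>v \<tau>)"
    by (rule cSup_eq_maximum) (use \<tau> max in auto)
  then show ?thesis using \<tau> max by auto
qed

lemma irrepresentable_mat_carrier:
  assumes S: "S \<subseteq> {..<dim_col X}"
    and inv: "invertible_mat (transpose_mat (col_submatrix X S) * col_submatrix X S)"
  shows "irrepresentable_mat X S \<in> carrier_mat (card ({..<dim_col X} - S)) (card S)"
proof -
  let ?G = "transpose_mat (col_submatrix X S) * col_submatrix X S"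
  have sets: "{j. j < dim_col X \<and> j \<in> S} = S"
      "{j. j < dim_col X \<and> j \<in> {..<dim_col X} - S} = {..<dim_col X} - S"
    using S by auto
  have G: "?G \<in> carrier_mat (card S) (card S)"
    by (auto simp: dim_submatrix sets)
  obtain B where B: "?G * B = 1\<^sub>m (dim_row ?G)" "B * ?G = 1\<^sub>m (dim_row B)"
    using inv by (auto simp: invertible_mat_def inverts_mat_def)
  have "B \<in> carrier_mat (card S) (card S)"
    using arg_cong[OF B(1), of dim_col] arg_cong[OF B(2), of dim_col]
    by (auto simp: dim_submatrix sets)
  then have "?G \<in> Units (ring_mat TYPE(real) (card S) ())"
    using B G by (auto simp: Units_def ring_mat_def dim_submatrix sets)
  then obtain C where C: "mat_inverse ?G = Some C"
    using mat_inverse(1)[OF G, of "()"] by (cases "mat_inverse ?G") auto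
  then have "C \<in> carrier_mat (card S) (card S)"
    using mat_inverse(2)[OF G] by blast
  moreover have "dim_col (col_submatrix X ({..<dim_col X} - S)) = card ({..<dim_col X} - S)"
    by (simp only: dim_submatrix sets)
  ultimately show ?thesis
    using C by (auto simp: irrepresentable_mat_def Let_def)
qed

end

theory Submission
  imports Defs
begin

text \<open>Write \<open>A\<close>, \<open>D\<close> for the columns of \<open>X\<close> inside and outside \<open>S\<close>, \<open>G = A\<^sup>T A\<close>, and pair
  \<open>\<beta>\<^sub>S\<close> with its sign vector \<open>\<tau>\<close>. With \<open>w = G\<^sup>-\<^sup>1 \<tau>\<close> and \<open>A \<beta>\<^sub>S = - D \<beta>\<^sub>C\<close>,
  \<open>\<parallel>\<beta>\<^sub>S\<parallel>\<^sub>1 = \<langle>G w, \<beta>\<^sub>S\<rangle> = \<langle>A w, A \<beta>\<^sub>S\<rangle> = - \<langle>D\<^sup>T A G\<^sup>-\<^sup>1 \<tau>, \<beta>\<^sub>C\<rangle>\<close>, and Hoelder's inequality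
  bounds this by the operator norm times \<open>\<parallel>\<beta>\<^sub>C\<parallel>\<^sub>1\<close>.\<close>

text \<open>\<open>pick S\<close> enumerates \<open>S\<close> in strictly increasing order, so it is
  injective on \<open>{..<card S}\<close>; its image lies in \<open>S\<close> and has the same
  cardinality. This converts sums over positions in a submatrix or subvector into sums over original
  indices.\<close>

lemma sum_pick:
  assumes "finite S"
  shows "(\<Sum>k<card S. f (pick S k)) = sum f S"
proof (rule sum.reindex_bij_betw)
  have inj: "inj_on (pick S) {..<card S}"
    by (rule linorder_inj_onI') (metis lessThan_iff pick_mono_le less_irrefl)
  moreover have "pick S ` {..<card S} = S"
    by (rule card_subset_eq) (auto simp: assms pick_in_set_le card_image[OF inj])
  ultimately show "bij_betw (pick S) {..<card S} S"
    by (simp add: bij_betw_def)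
qed

lemma col_submatrix_carrier:
  assumes "X \<in> carrier_mat n p" "S \<subseteq> {..<p}"
  shows "col_submatrix X S \<in> carrier_mat n (card S)"
proof -
  have "{j. j < p \<and> j \<in> S} = S" using assms by auto
  then show ?thesis using assms by (auto simp: submatrix_def)
qed

lemma subvec_carrier:
  assumes "\<beta> \<in> carrier_vec p" "S \<subseteq> {..<p}"
  shows "subvec \<beta> S \<in> carrier_vec (card S)"
proof -
  have "{j. j < p \<and> j \<in> S} = S" using assms by auto
  then show ?thesis using assms by (auto simp: subvec_def)
qed

lemma col_submatrix_mult_subvec:
  fixes X :: "'a :: comm_semiring_0 mat"
  assumes X: "X \<in> carrier_mat n p" and \<beta>: "\<beta> \<in> carrier_vec p" and S: "S \<subseteq> {..<p}"
    and i: "i < n"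
  shows "(col_submatrix X S *\<^sub>v subvec \<beta> S) $ i = (\<Sum>j\<in>S. X $$ (i, j) * \<beta> $ j)"
proof -
  have sel: "{j. j < p \<and> j \<in> S} = S" using S by auto
  have "(col_submatrix X S *\<^sub>v subvec \<beta> S) $ i
      = (\<Sum>k<card S. X $$ (i, pick S k) * \<beta> $ pick S k)"
    using X \<beta> i
    by (auto simp: submatrix_def subvec_def scalar_prod_def sel pick_UNIV lessThan_atLeast0
        intro!: sum.cong)
  also have "\<dots> = (\<Sum>j\<in>S. X $$ (i, j) * \<beta> $ j)"
    by (rule sum_pick) (use S finite_subset in auto)
  finally show ?thesis .
qed

text \<open>For \<beta> in the kernel this gives the relation between the two blocks on which the
  whole argument rests. Each row sum splits over \<open>S\<close> and its complement.\<close>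

lemma mult_mat_vec_split_columns:
  fixes X :: "'a :: comm_semiring_0 mat"
  assumes X: "X \<in> carrier_mat n p" and \<beta>: "\<beta> \<in> carrier_vec p" and S: "S \<subseteq> {..<p}"
  shows "X *\<^sub>v \<beta> = col_submatrix X S *\<^sub>v subvec \<beta> S
    + col_submatrix X ({..<p} - S) *\<^sub>v subvec \<beta> ({..<p} - S)"
proof (rule eq_vecI)
  note D = col_submatrix_carrier[OF X, of "{..<p} - S"]
  fix i assume "i < dim_vec (col_submatrix X S *\<^sub>v subvec \<beta> S
    + col_submatrix X ({..<p} - S) *\<^sub>v subvec \<beta> ({..<p} - S))"
  then have i: "i < n" using D by auto
  have "(X *\<^sub>v \<beta>) $ i = (\<Sum>j<p. X $$ (i, j) * \<beta> $ j)"
    using X \<beta> i by (auto simp: scalar_prod_def lessThan_atLeast0 intro!: sum.cong)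
  also have "\<dots> = (\<Sum>j\<in>S. X $$ (i, j) * \<beta> $ j) + (\<Sum>j\<in>{..<p} - S. X $$ (i, j) * \<beta> $ j)"
    using sum.subset_diff[OF S, of "\<lambda>j. X $$ (i, j) * \<beta> $ j"] by (simp add: add.commute)
  finally show "(X *\<^sub>v \<beta>) $ i = (col_submatrix X S *\<^sub>v subvec \<beta> S
    + col_submatrix X ({..<p} - S) *\<^sub>v subvec \<beta> ({..<p} - S)) $ i"
    using col_submatrix_mult_subvec[OF X \<beta> S i]
      col_submatrix_mult_subvec[OF X \<beta> Diff_subset i, of S] D i by auto
qed (use X col_submatrix_carrier[OF X, of "{..<p} - S"] in auto)

lemma mat_inverse_Some:
  fixes A :: "'a :: field mat"
  assumes A: "A \<in> carrier_mat n n" and "invertible_mat A"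
  obtains C where "mat_inverse A = Some C"
proof -
  obtain B where B: "A * B = 1\<^sub>m n" "B * A = 1\<^sub>m (dim_row B)"
    using assms by (auto simp: invertible_mat_def inverts_mat_def)
  \<comment> \<open>\<open>invertible_mat\<close> leaves the shape of the inverse implicit;
    comparing column counts in the two identities makes \<open>B\<close> square of size
    \<open>n\<close>.\<close>
  have "B \<in> carrier_mat n n"
    using arg_cong[OF B(1), of dim_col] arg_cong[OF B(2), of dim_col] A by auto
  then have "A \<in> Units (ring_mat TYPE('a) n ())"
    using B A by (auto simp: Units_def ring_mat_def)
  then show thesis
    using mat_inverse(1)[OF A, of "()"] that by (cases "mat_inverse A") auto
qed

lemma scalar_prod_le_linf_l1:
  assumes "dim_vec u = dim_vec v"
  shows "\<bar>u \<bullet> v\<bar> \<le> linf_norm u * l1_norm v"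
proof -
  have "\<bar>u \<bullet> v\<bar> \<le> (\<Sum>i<dim_vec v. \<bar>u $ i * v $ i\<bar>)"
    by (simp add: scalar_prod_def lessThan_atLeast0 sum_abs)
  also have "\<dots> \<le> (\<Sum>i<dim_vec v. linf_norm u * \<bar>v $ i\<bar>)"
    by (rule sum_mono) (auto simp: abs_mult assms intro!: mult_right_mono linf_norm_ge)
  finally show ?thesis by (simp add: l1_norm_def sum_distrib_left)
qed

lemma l1_norm_eq_scalar_prod_sgn: "l1_norm v = map_vec sgn v \<bullet> v"
  by (simp add: l1_norm_def scalar_prod_def lessThan_atLeast0 abs_sgn mult.commute)

text \<open>Makes the sign vector admissible in the supremum. Equality fails for zero vectors, since
  \<open>sgn 0 = 0\<close>.\<close>

lemma linf_norm_sgn: "linf_norm (map_vec sgn v) \<le> 1"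
  by (auto simp: linf_norm_le_iff sgn_if)

text \<open>The core estimate, freed from index sets: \<open>C\<close> stands for the inverse Gram
  matrix, and \<open>x\<close>, \<open>y\<close> for the two parts of \<beta>. The factor is the
  norm at one sign vector, so the supremum enters only later.\<close>

lemma l1_norm_le_of_add_eq_zero:
  fixes A D C :: "real mat"
  assumes A: "A \<in> carrier_mat n s" and D: "D \<in> carrier_mat n c" and C: "C \<in> carrier_mat s s"
    and GC: "(transpose_mat A * A) * C = 1\<^sub>m s"
    and x: "x \<in> carrier_vec s" and y: "y \<in> carrier_vec c"
    and eq: "A *\<^sub>v x + D *\<^sub>v y = 0\<^sub>v n"
  shows "l1_norm x
    \<le> linf_norm ((transpose_mat D * A * C) *\<^sub>v map_vec sgn x) * l1_norm y"
proof -
  define \<tau> where "\<tau> = map_vec sgn x"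
  define w where "w = C *\<^sub>v \<tau>"
  have \<tau>: "\<tau> \<in> carrier_vec s" using x by (simp add: \<tau>_def)
  have w: "w \<in> carrier_vec s" and Aw: "A *\<^sub>v w \<in> carrier_vec n"
    and Ax: "A *\<^sub>v x \<in> carrier_vec n" and Dy: "D *\<^sub>v y \<in> carrier_vec n"
    using \<tau> A C D x y by (auto simp: w_def)
  have AT: "transpose_mat A \<in> carrier_mat s n" and DT: "transpose_mat D \<in> carrier_mat c n"
    using A D by auto
  have "\<tau> = (transpose_mat A * A * C) *\<^sub>v \<tau>"
    using \<tau> by (simp add: GC)
  also have "\<dots> = (transpose_mat A * A) *\<^sub>v w"
    unfolding w_def using AT A C \<tau> by (intro assoc_mult_mat_vec) auto
  also have "\<dots> = transpose_mat A *\<^sub>v (A *\<^sub>v w)"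
    using AT A w by (intro assoc_mult_mat_vec)
  finally have \<tau>_eq: "\<tau> = transpose_mat A *\<^sub>v (A *\<^sub>v w)" .
  have "(transpose_mat D * A * C) *\<^sub>v \<tau> = (transpose_mat D * A) *\<^sub>v w"
    unfolding w_def using DT A C \<tau> by (intro assoc_mult_mat_vec) auto
  also have "\<dots> = transpose_mat D *\<^sub>v (A *\<^sub>v w)"
    using DT A w by (intro assoc_mult_mat_vec)
  finally have M: "(transpose_mat D * A * C) *\<^sub>v \<tau> = transpose_mat D *\<^sub>v (A *\<^sub>v w)" .
  \<comment> \<open>Pair \<open>A *\<^sub>v w\<close> with the vanishing sum. Moving
    \<open>A\<close> and \<open>D\<close> across the scalar product as transposes turns the two
    terms into \<open>l1_norm x\<close> and the term to be bounded.\<close>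
  have "0 = (A *\<^sub>v w) \<bullet> (A *\<^sub>v x + D *\<^sub>v y)"
    unfolding eq using Aw by simp
  also have "\<dots> = (A *\<^sub>v w) \<bullet> (A *\<^sub>v x) + (A *\<^sub>v w) \<bullet> (D *\<^sub>v y)"
    by (rule scalar_prod_add_distrib[OF Aw Ax Dy])
  also have "(A *\<^sub>v w) \<bullet> (A *\<^sub>v x) = \<tau> \<bullet> x"
    using transpose_vec_mult_scalar[OF A x Aw] \<tau>_eq by simp
  also have "(A *\<^sub>v w) \<bullet> (D *\<^sub>v y) = ((transpose_mat D * A * C) *\<^sub>v \<tau>) \<bullet> y"
    using transpose_vec_mult_scalar[OF D y Aw] M by simp
  finally have "l1_norm x = - (((transpose_mat D * A * C) *\<^sub>v \<tau>) \<bullet> y)"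
    by (simp add: l1_norm_eq_scalar_prod_sgn \<tau>_def)
  also have "\<dots> \<le> \<bar>((transpose_mat D * A * C) *\<^sub>v \<tau>) \<bullet> y\<bar>"
    by simp
  also have "\<dots> \<le> linf_norm ((transpose_mat D * A * C) *\<^sub>v \<tau>) * l1_norm y"
    by (rule scalar_prod_le_linf_l1) (use D y in auto)
  finally show ?thesis by (simp add: \<tau>_def)
qed

theorem proposition1:
  fixes X :: "real mat" and n p :: nat and S0 :: "nat set" and \<theta> :: real
  assumes "X \<in> carrier_mat n p"
    and "S0 \<subseteq> {..<p}"
    and "invertible_mat (transpose_mat (col_submatrix X S0) * col_submatrix X S0)"
    and "0 < \<theta>" and "\<theta> < 1"
    and "uniform_irrepresentable \<theta> X S0"
  shows "\<forall>\<rho>. \<theta> < \<rho> \<and> \<rho> < 1 \<longrightarrow> stable_null_space \<rho> X S0"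
proof (intro allI impI, unfold stable_null_space_def, intro ballI)
  fix \<rho> \<beta> assume \<rho>: "\<theta> < \<rho> \<and> \<rho> < 1" and ker: "\<beta> \<in> mat_kernel X"
  note X = assms(1) and S = assms(2)
  have p: "dim_col X = p" using X by simp
  let ?A = "col_submatrix X S0" and ?D = "col_submatrix X ({..<p} - S0)"
  let ?G = "transpose_mat ?A * ?A"
  let ?M = "irrepresentable_mat X S0"
  let ?x = "subvec \<beta> S0" and ?y = "subvec \<beta> ({..<p} - S0)"
  note \<beta> = mat_kernelD[OF X ker]
  have A: "?A \<in> carrier_mat n (card S0)" and D: "?D \<in> carrier_mat n (card ({..<p} - S0))"
    and x: "?x \<in> carrier_vec (card S0)" and y: "?y \<in> carrier_vec (card ({..<p} - S0))"
    using col_submatrix_carrier[OF X] subvec_carrier[OF \<beta>(1)] S by auto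
  have G: "?G \<in> carrier_mat (card S0) (card S0)" using A by auto
  obtain C where C: "mat_inverse ?G = Some C"
    using mat_inverse_Some[OF G assms(3)] .
  have "?A *\<^sub>v ?x + ?D *\<^sub>v ?y = 0\<^sub>v n"
    using mult_mat_vec_split_columns[OF X \<beta>(1) S] \<beta>(2) by simp
  moreover have "?G * C = 1\<^sub>m (card S0)" and "C \<in> carrier_mat (card S0) (card S0)"
    using mat_inverse(2)[OF G C] by auto
  ultimately have "l1_norm ?x
      \<le> linf_norm ((transpose_mat ?D * ?A * C) *\<^sub>v map_vec sgn ?x) * l1_norm ?y"
    using A D x y by (intro l1_norm_le_of_add_eq_zero)
  \<comment> \<open>As \<open>mat_inverse ?G\<close> is \<open>Some C\<close>, the
    \<open>the\<close> in the definition yields the genuine inverse.\<close>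
  moreover have "?M = transpose_mat ?D * ?A * C"
    by (simp add: irrepresentable_mat_def Let_def p C)
  ultimately have "l1_norm ?x \<le> linf_norm (?M *\<^sub>v map_vec sgn ?x) * l1_norm ?y"
    by simp
  also have "\<dots> \<le> \<rho> * l1_norm ?y"
  proof (rule mult_right_mono)
    have M: "?M \<in> carrier_mat (card ({..<p} - S0)) (card S0)"
      using irrepresentable_mat_carrier[of S0 X] assms(3) S p by auto
    have "map_vec sgn ?x \<in> {\<tau> \<in> carrier_vec (card S0). linf_norm \<tau> \<le> 1}"
      using x linf_norm_sgn by auto
    \<comment> \<open>A real \<open>SUP\<close> is sure to dominate its members only for sets
      bounded above; here it is attained at a maximiser, which settles this.\<close>
    then have "linf_norm (?M *\<^sub>v map_vec sgn ?x)
        \<le> (SUP \<tau> \<in> {\<tau> \<in> carrier_vec (card S0). linf_norm \<tau> \<le> 1}. linf_norm (?M *\<^sub>v \<tau>))"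
      using linf_operator_max_attained[OF M] by fastforce
    then show "linf_norm (?M *\<^sub>v map_vec sgn ?x) \<le> \<rho>"
      using assms(6) \<rho> unfolding uniform_irrepresentable_def by linarith
  qed (simp add: l1_norm_def sum_nonneg)
  finally show "l1_norm ?x \<le> \<rho> * l1_norm (subvec \<beta> ({..<dim_col X} - S0))"
    unfolding p .
qed

end
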